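(* Let $n,m,d\in\mathbb{N}$, $n_x=nd$, $n_y=md$, and let $D\in\mathbb{R}^{n_y\times n_x}$ with $D[i]^TD[i]=I_d$ for $i=1,\dots,n$. The minimizer $B\in\mathbb{R}^{n_y\times n_x}$ of $$\min_{B\in\mathbb{R}^{n_y\times n_x}}\frac1d\|B^TD\|_F^2\quad\text{s.t. } B[i]^TD[i]=I_d\ \text{ for } i=1,\dots,n$$ is given as the concatenation $B=(B[1],B[2],\dots,B[n])$, where the $n$ blocks are $$B[i]=K_i^+\left(D[i]-E_iH_i\right)$$ with, for $i=1,\dots,n$, \begin{align*} K_i&=(2DD^T)^2+D[i]D[i]^T,\\ E_i&=2DD^TD[i],\\ R_i&=D[i]-2DD^TK_i^+E_i,\\ S_i&=-D[i]^TK_i^+E_i,\\ L_i&=R_i^TR_i+S_i^TS_i,\\ M_i&=K_i^+E_i(I-L_i^+L_i),\\ H_i&=L_i^+S_i^T+(I-L_i^+L_i)(I+M_i^TM_i)^{-1}(K_i^+E_i)^TK_i^+\left(D[i]-E_iL_i^+S_i^T\right). \end{align*}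
   Context: A matrix $A\in\mathbb{R}^{n_y\times n_x}$ with $n_x=nd$ is split into $n$ consecutive column blocks $A=(A[1],\dots,A[n])$ with $A[i]\in\mathbb{R}^{n_y\times d}$. $A^+$ denotes the Moore–Penrose pseudoinverse, $\|\cdot\|_F$ the Frobenius norm, $I_d$ the $d\times d$ identity and $I$ an identity matrix of appropriate size.
   Formalization: The minimizer need not be unique (n=d=1, m=2, D=(1,0)^T: every B=(1,t)^T is feasible with the same objective), so the formal theorem states that the displayed B is feasible and is a minimizer; where the minimizer is unique, it is this B. *)

theory Defs
  imports "HOL-Analysis.Analysis"
begin

text \<open>
  A real matrix with \<open>n \<cdot> d\<close> columns that are split into \<open>n\<close> consecutive blocks of width \<open>d\<close> has
  the column index type \<open>'n \<times> 'd\<close>: the column \<open>(i, c)\<close> is column \<open>c\<close> of block \<open>i\<close>.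
\<close>

definition block :: "real ^ ('n::finite \<times> 'd::finite) ^ 'r::finite \<Rightarrow> 'n \<Rightarrow> real ^ 'd ^ 'r" where
  "block A i = (\<chi> r c. A $ r $ (i, c))"

definition concat_blocks :: "('n::finite \<Rightarrow> real ^ 'd::finite ^ 'r::finite) \<Rightarrow> real ^ ('n \<times> 'd) ^ 'r" where
  "concat_blocks F = (\<chi> r j. F (fst j) $ r $ snd j)"

lemma block_concat_blocks [simp]: "block (concat_blocks F) i = F i"
  by (simp add: block_def concat_blocks_def vec_eq_iff)

lemma concat_blocks_block [simp]: "concat_blocks (block A) = A"
  by (simp add: block_def concat_blocks_def vec_eq_iff)

definition frobenius_norm :: "real ^ 'c::finite ^ 'r::finite \<Rightarrow> real" where
  "frobenius_norm A = sqrt (\<Sum>r\<in>UNIV. \<Sum>c\<in>UNIV. (A $ r $ c)\<^sup>2)"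

lemma frobenius_norm_eq_norm: "frobenius_norm A = norm A"
  by (simp add: frobenius_norm_def norm_vec_def L2_set_def sum_nonneg)

definition is_pseudoinverse :: "real ^ 'c::finite ^ 'r::finite \<Rightarrow> real ^ 'r ^ 'c \<Rightarrow> bool" where
  "is_pseudoinverse A X \<longleftrightarrow>
     A ** X ** A = A \<and> X ** A ** X = X \<and>
     transpose (A ** X) = A ** X \<and> transpose (X ** A) = X ** A"

definition pseudoinverse :: "real ^ 'c::finite ^ 'r::finite \<Rightarrow> real ^ 'r ^ 'c" where
  "pseudoinverse A = (THE X. is_pseudoinverse A X)"

lemma is_pseudoinverse_unique:
  assumes "is_pseudoinverse A X" "is_pseudoinverse A Y"
  shows "X = Y"
proof -
  have "A ** X = A ** Y"
  proof -
    have "A ** X = transpose (A ** Y ** A ** X)"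
      using assms by (simp add: is_pseudoinverse_def)
    also have "\<dots> = transpose (A ** X) ** transpose (A ** Y)"
      by (simp add: matrix_transpose_mul matrix_mul_assoc)
    also have "\<dots> = A ** X ** A ** Y"
      using assms by (simp add: is_pseudoinverse_def matrix_mul_assoc)
    also have "\<dots> = A ** Y"
      using assms by (simp add: is_pseudoinverse_def)
    finally show ?thesis .
  qed
  moreover have "X ** A = Y ** A"
  proof -
    have "X ** A = transpose (X ** (A ** Y ** A))"
      using assms by (simp add: is_pseudoinverse_def)
    also have "\<dots> = transpose (Y ** A) ** transpose (X ** A)"
      by (simp add: matrix_transpose_mul matrix_mul_assoc)
    also have "\<dots> = Y ** (A ** X ** A)"
      using assms unfolding is_pseudoinverse_def by (metis matrix_mul_assoc)
    also have "\<dots> = Y ** A"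
      using assms by (simp add: is_pseudoinverse_def)
    finally show ?thesis .
  qed
  ultimately have "X ** A ** X = Y ** A ** Y"
    by (metis matrix_mul_assoc)
  then show ?thesis
    using assms by (simp add: is_pseudoinverse_def)
qed

lemma normal_equation_solvable:
  fixes A :: "real ^ 'c::finite ^ 'r::finite"
  shows "\<exists>G. transpose A ** A ** G = transpose A"
proof -
  have "\<exists>x. (transpose A ** A) *v x = transpose A *v y" for y
  proof -
    obtain p z where p: "p \<in> span (range ((*v) A))"
      and z: "\<And>w. w \<in> span (range ((*v) A)) \<Longrightarrow> orthogonal z w" and y: "y = p + z"
      using orthogonal_subspace_decomp_exists by metis
    have "span (range ((*v) A)) = range ((*v) A)"
      using linear_subspace_image[OF matrix_vector_mul_linear subspace_UNIV] span_eq_iff by blast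
    with p obtain x where x: "p = A *v x" by auto
    have "transpose A *v z = 0"
    proof -
      have "(transpose A *v z) \<bullet> w = 0" for w
        using z[of "A *v w"] by (simp add: dot_lmul_matrix orthogonal_def span_base)
      then show ?thesis
        using inner_eq_zero_iff by blast
    qed
    then show ?thesis
      using x y by (metis add.right_neutral matrix_vector_mul_assoc matrix_vector_right_distrib)
  qed
  then obtain g where g: "\<And>y. (transpose A ** A) *v g y = transpose A *v y"
    by metis
  define G where "G = (\<chi> i j. g (axis j 1) $ i)"
  have "column j (transpose A ** A ** G) = column j (transpose A)" for j
  proof -
    have "column j G = g (axis j 1)"
      by (simp add: G_def column_def vec_eq_iff)
    then have "column j (transpose A ** A ** G) = (transpose A ** A) *v g (axis j 1)"
      by (metis matrix_vector_mul_assoc matrix_vector_mult_basis)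
    also have "\<dots> = column j (transpose A)"
      by (simp add: g matrix_vector_mult_basis)
    finally show ?thesis .
  qed
  then have "transpose A ** A ** G = transpose A"
    by (simp add: column_def vec_eq_iff)
  then show ?thesis ..
qed

lemma symmetric_right_inner_inverse:
  fixes A :: "real ^ 'c::finite ^ 'r::finite"
  obtains G where "A ** G ** A = A" "transpose (A ** G) = A ** G"
proof -
  obtain G where G: "transpose A ** A ** G = transpose A"
    using normal_equation_solvable by blast
  have "transpose (A ** G) ** (A ** G) = transpose (A ** G)"
    using G by (metis matrix_mul_assoc matrix_transpose_mul)
  then have sym: "transpose (A ** G) = A ** G"
    by (metis matrix_transpose_mul transpose_transpose)
  have "transpose (transpose A ** (A ** G)) = A"
    using G by (simp add: matrix_mul_assoc)
  then have "A ** G ** A = A"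
    by (simp add: matrix_transpose_mul[of "transpose A"] sym)
  with sym show ?thesis using that by blast
qed

lemma pseudoinverse_ex1: "\<exists>!X. is_pseudoinverse A X"
proof -
  obtain G where G: "A ** G ** A = A" "transpose (A ** G) = A ** G"
    using symmetric_right_inner_inverse .
  obtain F' where F': "transpose A ** F' ** transpose A = transpose A"
      "transpose (transpose A ** F') = transpose A ** F'"
    using symmetric_right_inner_inverse .
  define F where "F = transpose F'"
  have F: "A ** F ** A = A" "transpose (F ** A) = F ** A"
    using F' unfolding F_def
    by (metis matrix_mul_assoc matrix_transpose_mul transpose_transpose)+
  define X where "X = F ** A ** G"
  have AX: "A ** X = A ** G" and XA: "X ** A = F ** A"
    using F G unfolding X_def by (metis matrix_mul_assoc)+
  have "X ** A ** X = X"
    unfolding XA using F by (metis X_def matrix_mul_assoc)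
  then have "is_pseudoinverse A X"
    using F G by (simp add: is_pseudoinverse_def AX XA)
  then show ?thesis
    using is_pseudoinverse_unique by blast
qed

lemma is_pseudoinverse_pseudoinverse: "is_pseudoinverse A (pseudoinverse A)"
  unfolding pseudoinverse_def by (rule theI'[OF pseudoinverse_ex1])

end

theory Submission
  imports Defs
begin

text \<open>
  The problem decouples into one convex quadratic problem for each block. Its optimality conditions
  for \<open>B = B[i]\<close> with multiplier \<open>\<Lambda>\<close> are \<open>2DD\<^sup>TB + D[i]\<Lambda> = 0\<close> and \<open>D[i]\<^sup>TB = I\<close>, that is,
  \<open>(U V)\<close> applied to \<open>(B, \<Lambda>)\<close> equals \<open>(0, I)\<close>, where \<open>U\<close> stacks \<open>2DD\<^sup>T\<close> over \<open>D[i]\<^sup>T\<close> and \<open>V\<close> stacks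
  \<open>D[i]\<close> over \<open>0\<close>. This system is solvable because the columns of \<open>D[i]\<close> lie in the range of
  \<open>DD\<^sup>T\<close> and are independent. The stated formula is Cline's expression for the pseudoinverse of
  \<open>(U V)\<close>: one has \<open>K = U\<^sup>TU\<close>, \<open>E = U\<^sup>TV\<close>, and \<open>R\<close> over \<open>S\<close> is the projection of \<open>V\<close> onto the orthogonal
  complement of the range of \<open>U\<close>, with Gram matrix \<open>L\<close>. The second summand of \<open>H\<close> lies in the kernel of \<open>L\<close>,
  hence in that of \<open>R\<close> and \<open>S\<close>; it only selects the solution of minimal norm and does not affect
  optimality.
\<close>

section \<open>Elementary matrix algebra\<close>

lemma matrix_mult_zero [simp]:
  fixes A :: "real ^ 'c::finite ^ 'r::finite"
  shows "A ** (0 :: real ^ 'k::finite ^ 'c) = 0" "(0 :: real ^ 'r ^ 'k) ** A = 0"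
  by (simp_all add: matrix_matrix_mult_def vec_eq_iff)

lemma matrix_diff_ldistrib:
  fixes A :: "real ^ 'c::finite ^ 'r::finite"
  shows "A ** (B - C) = A ** B - A ** C"
  by (simp add: matrix_matrix_mult_def vec_eq_iff right_diff_distrib sum_subtractf)

lemma matrix_diff_rdistrib:
  fixes A :: "real ^ 'c::finite ^ 'r::finite"
  shows "(A - B) ** C = A ** C - B ** C"
  by (simp add: matrix_matrix_mult_def vec_eq_iff left_diff_distrib sum_subtractf)

lemma matrix_add_rdistrib:
  fixes A :: "real ^ 'c::finite ^ 'r::finite"
  shows "(A + B) ** C = A ** C + B ** C"
  by (simp add: matrix_matrix_mult_def vec_eq_iff distrib_right sum.distrib)

lemma matrix_minus_mult:
  fixes A :: "real ^ 'c::finite ^ 'r::finite"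
  shows "(- A) ** B = - (A ** B)" "A ** (- B) = - (A ** B)"
  by (simp_all add: matrix_matrix_mult_def vec_eq_iff sum_negf)

lemma transpose_diff: "transpose (A - B) = transpose A - transpose B"
  for A :: "real ^ 'c::finite ^ 'r::finite"
  by (simp add: transpose_def vec_eq_iff)

lemma transpose_add: "transpose (A + B) = transpose A + transpose B"
  for A :: "real ^ 'c::finite ^ 'r::finite"
  by (simp add: transpose_def vec_eq_iff)

lemma transpose_minus: "transpose (- A) = - transpose A"
  for A :: "real ^ 'c::finite ^ 'r::finite"
  by (simp add: transpose_def vec_eq_iff)

section \<open>The Frobenius inner product\<close>

text \<open>Lets orthogonality and kernel arguments run on whole matrices instead of column by
  column.\<close>

lemma inner_matrix_mult_left:
  fixes A :: "real ^ 'k::finite ^ 'r::finite" and B :: "real ^ 'c::finite ^ 'k"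
  shows "(A ** B) \<bullet> C = B \<bullet> (transpose A ** C)"
proof -
  have "(A ** B) \<bullet> C = (\<Sum>r\<in>UNIV. \<Sum>c\<in>UNIV. \<Sum>k\<in>UNIV. A $ r $ k * B $ k $ c * C $ r $ c)"
    by (simp add: inner_vec_def matrix_matrix_mult_def sum_distrib_right)
  also have "\<dots> = (\<Sum>r\<in>UNIV. \<Sum>k\<in>UNIV. \<Sum>c\<in>UNIV. A $ r $ k * B $ k $ c * C $ r $ c)"
    by (intro sum.cong refl sum.swap)
  also have "\<dots> = (\<Sum>k\<in>UNIV. \<Sum>r\<in>UNIV. \<Sum>c\<in>UNIV. A $ r $ k * B $ k $ c * C $ r $ c)"
    by (rule sum.swap)
  also have "\<dots> = (\<Sum>k\<in>UNIV. \<Sum>c\<in>UNIV. \<Sum>r\<in>UNIV. A $ r $ k * B $ k $ c * C $ r $ c)"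
    by (intro sum.cong refl sum.swap)
  also have "\<dots> = B \<bullet> (transpose A ** C)"
    by (simp add: inner_vec_def matrix_matrix_mult_def transpose_def sum_distrib_left mult_ac)
  finally show ?thesis .
qed

lemma norm_transpose: "norm (transpose A) = norm A"
  for A :: "real ^ 'c::finite ^ 'r::finite"
proof -
  have "transpose A \<bullet> transpose A = A \<bullet> A"
    unfolding inner_vec_def transpose_def by (simp add: sum.swap[of "\<lambda>i j. A $ j $ i * A $ j $ i"])
  then show ?thesis
    by (simp add: norm_eq_sqrt_inner)
qed

section \<open>Gram matrices and their pseudoinverses\<close>

text \<open>Pairing the hypothesis with \<open>N\<close> gives the sum of the squared norms of
  \<open>X ** N\<close> and \<open>Y ** N\<close>, so both vanish.\<close>

lemma gram_sum_kernel:
  fixes X :: "real ^ 'c::finite ^ 'r::finite" and Y :: "real ^ 'c ^ 's::finite"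
    and N :: "real ^ 'k::finite ^ 'c"
  assumes "(transpose X ** X + transpose Y ** Y) ** N = 0"
  shows "X ** N = 0"
proof -
  have "(X ** N) \<bullet> (X ** N) + (Y ** N) \<bullet> (Y ** N)
      = N \<bullet> ((transpose X ** X + transpose Y ** Y) ** N)"
    by (simp add: inner_matrix_mult_left matrix_mul_assoc matrix_add_rdistrib inner_add_right)
  also have "\<dots> = 0"
    by (simp add: assms)
  finally show ?thesis
    by (smt (verit) inner_ge_zero inner_eq_zero_iff)
qed

text \<open>The columns of \<open>mat 1 - pseudoinverse K ** K\<close> lie in the kernel of
  \<open>K\<close>, hence in that of \<open>X\<close>. This permits cancellation where
  \<open>K\<close> may be singular.\<close>

lemma gram_pseudoinverse:
  fixes X :: "real ^ 'c::finite ^ 'r::finite" and Y :: "real ^ 'c ^ 's::finite"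
  assumes K: "K = transpose X ** X + transpose Y ** Y"
  shows "X ** pseudoinverse K ** K = X"
proof -
  have "K ** (mat 1 - pseudoinverse K ** K) = 0"
    using is_pseudoinverse_pseudoinverse[of K]
    by (simp add: is_pseudoinverse_def matrix_diff_ldistrib matrix_mul_assoc)
  then have "X ** (mat 1 - pseudoinverse K ** K) = 0"
    using gram_sum_kernel unfolding K by blast
  then show ?thesis
    by (simp add: matrix_diff_ldistrib matrix_mul_assoc)
qed

lemma transpose_pseudoinverse: "transpose (pseudoinverse A) = pseudoinverse (transpose A)"
proof (rule is_pseudoinverse_unique[OF _ is_pseudoinverse_pseudoinverse])
  show "is_pseudoinverse (transpose A) (transpose (pseudoinverse A))"
    using is_pseudoinverse_pseudoinverse[of A] unfolding is_pseudoinverse_def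
    by (metis matrix_mul_assoc matrix_transpose_mul)
qed

section \<open>The optimality system of one block\<close>

lemma block_eq_mult: "\<exists>J. block A i = A ** J"
  for A :: "real ^ ('n::finite \<times> 'd::finite) ^ 'r::finite"
proof
  show "block A i = A ** (\<chi> j c. if j = (i, c) then 1 else 0)"
    by (simp add: block_def matrix_matrix_mult_def vec_eq_iff if_distrib cong: if_cong)
qed

text \<open>If \<open>D ** transpose D ** Z = F\<close> and \<open>W = transpose F ** Z\<close> is
  invertible, then \<open>Z\<close> times the inverse of \<open>W\<close>, with -2 times that
  inverse as multiplier, solves the system. Invertibility holds because \<open>W\<close> is the Gram
  matrix of \<open>P = transpose D ** Z\<close>, which has the left inverse
  \<open>transpose F ** D\<close>.\<close>

lemma kkt_solvable:
  fixes D :: "real ^ 'k::finite ^ 'r::finite" and F :: "real ^ 'c::finite ^ 'r"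
  assumes F: "F = D ** J" and orth: "transpose F ** F = mat 1"
  shows "\<exists>B \<Lambda>. 2 *\<^sub>R (D ** transpose D) ** B + F ** \<Lambda> = 0 \<and> transpose F ** B = mat 1"
proof -
  \<comment> \<open>The normal equation of \<open>transpose D\<close> shows that
    \<open>D ** transpose D\<close> has the range of \<open>D\<close>.\<close>
  obtain G where G: "D ** transpose D ** G = D"
    using normal_equation_solvable[of "transpose D"] by auto
  define Z where "Z = G ** J"
  have Z: "D ** transpose D ** Z = F"
    by (simp add: Z_def G F matrix_mul_assoc)
  define P where "P = transpose D ** Z"
  define W where "W = transpose P ** P"
  have DP: "D ** P = F"
    using Z by (simp add: P_def matrix_mul_assoc)
  have W: "W = transpose Z ** F"
    by (metis DP P_def W_def matrix_mul_assoc matrix_transpose_mul transpose_transpose)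
  have W': "W = transpose F ** Z"
    by (metis W W_def matrix_transpose_mul transpose_transpose)
  \<comment> \<open>\<open>N\<close> projects onto the kernel of \<open>W\<close>;
    \<open>N = 0\<close> makes the pseudoinverse a left inverse, hence an inverse since
    \<open>W\<close> is square.\<close>
  define N where "N = mat 1 - pseudoinverse W ** W"
  have "W ** N = 0"
    using is_pseudoinverse_pseudoinverse[of W]
    by (simp add: N_def is_pseudoinverse_def matrix_diff_ldistrib matrix_mul_assoc)
  then have "P ** N = 0"
    using gram_sum_kernel[of P "0 :: real ^ 'c ^ 'c" N] by (simp add: W_def)
  moreover have "N = transpose F ** D ** (P ** N)"
    by (metis DP matrix_mul_assoc matrix_mul_lid orth)
  ultimately have "N = 0"
    by simp
  then have inv: "W ** pseudoinverse W = mat 1"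
    using matrix_left_right_inverse[of "pseudoinverse W" W] by (simp add: N_def)
  define B where "B = Z ** pseudoinverse W"
  have "transpose F ** B = mat 1"
    using inv by (simp add: B_def matrix_mul_assoc W')
  moreover have "2 *\<^sub>R (D ** transpose D) ** B + F ** ((- 2) *\<^sub>R pseudoinverse W) = 0"
    using Z by (simp add: B_def matrix_mul_assoc matrix_scalar_ac matrix_minus_mult
        flip: scalar_matrix_assoc)
  ultimately show ?thesis
    by blast
qed

text \<open>Any solution \<open>(B0, \<Lambda>)\<close> serves for comparison: the columns of
  \<open>H - \<Lambda>\<close> lie in the kernel of \<open>L\<close>, so \<open>H\<close> and
  \<open>\<Lambda>\<close> agree under \<open>R\<close> and \<open>S\<close>. \<open>W\<close>
  abstracts what follows the kernel projection in \<open>H\<close>.\<close>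

lemma kkt_solution:
  fixes G K :: "real ^ 'r::finite ^ 'r" and F E R :: "real ^ 'c::finite ^ 'r" and S L W :: "real ^ 'c ^ 'c"
  assumes G: "transpose G = G"
    and solvable: "G ** B0 + F ** \<Lambda> = 0" "transpose F ** B0 = mat 1"
    and K: "K = G ** G + F ** transpose F"
    and E: "E = G ** F"
    and R: "R = F - G ** pseudoinverse K ** E"
    and S: "S = - (transpose F ** pseudoinverse K ** E)"
    and L: "L = transpose R ** R + transpose S ** S"
    and H: "H = pseudoinverse L ** transpose S + (mat 1 - pseudoinverse L ** L) ** W"
    and B: "B = pseudoinverse K ** (F - E ** H)"
  shows "G ** B + F ** H = 0" "transpose F ** B = mat 1"
proof -
  let ?K' = "pseudoinverse K"
  have Ksym: "transpose K = K"
    by (simp add: K transpose_add matrix_transpose_mul G)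
  have K'sym: "transpose ?K' = ?K'"
    by (simp add: transpose_pseudoinverse Ksym)
  have GK: "G ** ?K' ** K = G"
    by (rule gram_pseudoinverse[of _ _ "transpose F"]) (simp add: K G)
  have FK: "transpose F ** ?K' ** K = transpose F"
    by (rule gram_pseudoinverse[of _ _ G]) (simp add: K G add.commute)
  have EK: "transpose E ** ?K' ** K = transpose E"
    by (metis E G GK matrix_mul_assoc matrix_transpose_mul)
  have Rt: "transpose R = transpose F - transpose E ** ?K' ** G"
    by (simp add: R transpose_diff matrix_transpose_mul G K'sym matrix_mul_assoc)
  have St: "transpose S = - (transpose E ** ?K' ** F)"
    by (simp add: S transpose_minus matrix_transpose_mul K'sym matrix_mul_assoc)
  \<comment> \<open>Orthogonality of \<open>R\<close> over \<open>S\<close> to the range of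
    \<open>U\<close>.\<close>
  have orthU: "transpose R ** G + transpose S ** transpose F = 0"
  proof -
    have "transpose R ** G + transpose S ** transpose F = transpose E - transpose E ** ?K' ** K"
      by (simp add: Rt St K E matrix_diff_rdistrib matrix_minus_mult matrix_add_ldistrib
          matrix_transpose_mul G matrix_mul_assoc)
    then show ?thesis
      by (simp add: EK)
  qed
  \<comment> \<open>By orthogonality, the Gram matrix of the projected \<open>V\<close> is its
    product with \<open>V\<close>, whose lower block is zero.\<close>
  have RF: "transpose R ** F = L"
  proof -
    have "transpose R ** R = transpose R ** F - transpose R ** G ** ?K' ** E"
      using arg_cong[OF R, of "(**) (transpose R)"]
      by (simp add: matrix_diff_ldistrib matrix_mul_assoc)
    moreover have "transpose S ** S = - (transpose S ** transpose F ** ?K' ** E)"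
      using arg_cong[OF S, of "(**) (transpose S)"]
      by (simp add: matrix_minus_mult matrix_mul_assoc)
    ultimately have "L = transpose R ** F
        - (transpose R ** G + transpose S ** transpose F) ** ?K' ** E"
      by (simp add: L matrix_add_rdistrib)
    then show ?thesis
      by (simp add: orthU)
  qed
  \<comment> \<open>Multiplying the system for \<open>(B0, \<Lambda>)\<close> by the transpose of
    \<open>R\<close> over \<open>S\<close> kills the \<open>U\<close> part and turns the right side
    \<open>(0, I)\<close> into \<open>transpose S\<close>.\<close>
  have SL: "transpose S = L ** \<Lambda>"
  proof -
    have "transpose R ** (G ** B0 + F ** \<Lambda>) + transpose S ** (transpose F ** B0)
        = (transpose R ** G + transpose S ** transpose F) ** B0 + L ** \<Lambda>"
      by (simp add: matrix_add_ldistrib matrix_add_rdistrib matrix_mul_assoc RF)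
    then show ?thesis
      by (simp add: solvable orthU)
  qed
  have RL: "R ** pseudoinverse L ** L = R"
    by (rule gram_pseudoinverse[OF L])
  have "L = transpose S ** S + transpose R ** R"
    by (simp add: L add.commute)
  then have SL': "S ** pseudoinverse L ** L = S"
    by (rule gram_pseudoinverse)
  have RH: "R ** H = R ** \<Lambda>"
    by (simp add: H SL matrix_add_ldistrib matrix_diff_ldistrib matrix_diff_rdistrib
        matrix_mul_assoc RL)
  have SH: "S ** H = S ** \<Lambda>"
    by (simp add: H SL matrix_add_ldistrib matrix_diff_ldistrib matrix_diff_rdistrib
        matrix_mul_assoc SL')
  \<comment> \<open>The same system multiplied by the transpose of \<open>U\<close>.\<close>
  have rhs: "F = K ** B0 + E ** \<Lambda>"
  proof -
    have "K ** B0 + E ** \<Lambda> = G ** (G ** B0 + F ** \<Lambda>) + F ** (transpose F ** B0)"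
      by (simp add: K E matrix_add_ldistrib matrix_add_rdistrib matrix_mul_assoc)
    then show ?thesis
      by (simp add: solvable)
  qed
  have "G ** B + F ** H = G ** ?K' ** F + R ** H"
    by (simp add: B R matrix_diff_ldistrib matrix_diff_rdistrib matrix_mul_assoc)
  also have "\<dots> = G ** ?K' ** K ** B0 + (G ** ?K' ** E ** \<Lambda> + R ** \<Lambda>)"
    by (subst rhs) (simp add: RH matrix_add_ldistrib matrix_mul_assoc)
  also have "\<dots> = G ** B0 + F ** \<Lambda>"
    by (simp add: GK R matrix_diff_rdistrib)
  finally show "G ** B + F ** H = 0"
    by (simp add: solvable)
  have "transpose F ** B = transpose F ** ?K' ** F + S ** H"
    by (simp add: B S matrix_diff_ldistrib matrix_minus_mult matrix_mul_assoc)
  also have "\<dots> = transpose F ** ?K' ** K ** B0 + (transpose F ** ?K' ** E ** \<Lambda> + S ** \<Lambda>)"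
    by (subst (2) rhs) (simp add: SH matrix_add_ldistrib matrix_mul_assoc)
  also have "\<dots> = transpose F ** B0"
    by (simp add: FK S matrix_minus_mult)
  finally show "transpose F ** B = mat 1"
    by (simp add: solvable)
qed

section \<open>Optimality and decoupling\<close>

text \<open>A feasible direction \<open>N\<close> has \<open>transpose F ** N = 0\<close>, so
  stationarity makes \<open>transpose D ** N\<close> orthogonal to \<open>transpose D ** B\<close>;
  Pythagoras gives the inequality.\<close>

lemma kkt_optimal:
  fixes D :: "real ^ 'k::finite ^ 'r::finite" and F B B' :: "real ^ 'c::finite ^ 'r"
  assumes stationary: "2 *\<^sub>R (D ** transpose D) ** B + F ** \<Lambda> = 0"
    and feasible: "transpose F ** B = transpose F ** B'"
  shows "norm (transpose B ** D) \<le> norm (transpose B' ** D)"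
proof -
  define N where "N = B' - B"
  have FN: "transpose F ** N = 0"
    by (simp add: N_def matrix_diff_ldistrib feasible)
  have "2 * ((transpose D ** N) \<bullet> (transpose D ** B)) = N \<bullet> (2 *\<^sub>R (D ** transpose D) ** B)"
    by (simp add: inner_matrix_mult_left matrix_mul_assoc flip: scalar_matrix_assoc)
  also have "\<dots> = - (N \<bullet> (F ** \<Lambda>))"
    using arg_cong[OF stationary, of "inner N"] by (simp add: inner_add_right)
  also have "\<dots> = 0"
    using FN by (simp add: inner_matrix_mult_left inner_commute[of N])
  finally have orth: "(transpose D ** N) \<bullet> (transpose D ** B) = 0"
    by simp
  have "transpose D ** B' = transpose D ** N + transpose D ** B"
    by (simp add: N_def matrix_diff_ldistrib)
  then have "(norm (transpose D ** B'))\<^sup>2 = (norm (transpose D ** N))\<^sup>2 + (norm (transpose D ** B))\<^sup>2"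
    using orth by (simp add: norm_add_Pythagorean orthogonal_def)
  then have "norm (transpose D ** B) \<le> norm (transpose D ** B')"
    using zero_le_power2[of "norm (transpose D ** N)"]
    by - (rule power2_le_imp_le, simp_all)
  moreover have "norm (transpose X ** D) = norm (transpose D ** X)" for X :: "real ^ 'c ^ 'r"
    using norm_transpose[of "transpose X ** D"] by (simp add: matrix_transpose_mul)
  ultimately show ?thesis
    by simp
qed

text \<open>Rows of \<open>transpose B ** D\<close> are indexed by the columns of \<open>B\<close>,
  so the objective splits by blocks.\<close>

lemma frobenius_norm_blocks:
  fixes B :: "real ^ ('n::finite \<times> 'd::finite) ^ 'r::finite" and D :: "real ^ 'k::finite ^ 'r"
  shows "(frobenius_norm (transpose B ** D))\<^sup>2 = (\<Sum>i\<in>UNIV. (norm (transpose (block B i) ** D))\<^sup>2)"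
proof -
  have split: "sum g UNIV = (\<Sum>i\<in>UNIV. \<Sum>b\<in>UNIV. g (i, b))" for g :: "'n \<times> 'd \<Rightarrow> real"
    by (simp add: sum.cartesian_product)
  have "(frobenius_norm (transpose B ** D))\<^sup>2
      = (\<Sum>j\<in>UNIV. \<Sum>c\<in>UNIV. ((transpose B ** D) $ j $ c)\<^sup>2)"
    by (simp add: frobenius_norm_def sum_nonneg)
  also have "\<dots> = (\<Sum>i\<in>UNIV. \<Sum>b\<in>UNIV. \<Sum>c\<in>UNIV. ((transpose B ** D) $ (i, b) $ c)\<^sup>2)"
    by (rule split)
  also have "\<dots> = (\<Sum>i\<in>UNIV. (frobenius_norm (transpose (block B i) ** D))\<^sup>2)"
    by (simp add: frobenius_norm_def sum_nonneg block_def transpose_def matrix_matrix_mult_def)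
  finally show ?thesis
    by (simp add: frobenius_norm_eq_norm)
qed

theorem theorem3:
  fixes D :: "real ^ ('n::finite \<times> 'd::finite) ^ ('m::finite \<times> 'd)"
    and K :: "'n \<Rightarrow> real ^ ('m \<times> 'd) ^ ('m \<times> 'd)"
    and E R M :: "'n \<Rightarrow> real ^ 'd ^ ('m \<times> 'd)"
    and S L H :: "'n \<Rightarrow> real ^ 'd ^ 'd"
  assumes D: "\<And>i. transpose (block D i) ** block D i = mat 1"
    and K: "\<And>i. K i = (2 *\<^sub>R (D ** transpose D)) ** (2 *\<^sub>R (D ** transpose D))
                    + block D i ** transpose (block D i)"
    and E: "\<And>i. E i = 2 *\<^sub>R (D ** transpose D ** block D i)"
    and R: "\<And>i. R i = block D i - 2 *\<^sub>R (D ** transpose D ** pseudoinverse (K i) ** E i)"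
    and S: "\<And>i. S i = - (transpose (block D i) ** pseudoinverse (K i) ** E i)"
    and L: "\<And>i. L i = transpose (R i) ** R i + transpose (S i) ** S i"
    and M: "\<And>i. M i = pseudoinverse (K i) ** E i ** (mat 1 - pseudoinverse (L i) ** L i)"
    and H: "\<And>i. H i = pseudoinverse (L i) ** transpose (S i)
                    + (mat 1 - pseudoinverse (L i) ** L i)
                      ** matrix_inv (mat 1 + transpose (M i) ** M i)
                      ** transpose (pseudoinverse (K i) ** E i)
                      ** pseudoinverse (K i)
                      ** (block D i - E i ** pseudoinverse (L i) ** transpose (S i))"
  shows "is_arg_min
           (\<lambda>B :: real ^ ('n \<times> 'd) ^ ('m \<times> 'd).
              1 / real CARD('d) * (frobenius_norm (transpose B ** D))\<^sup>2)
           (\<lambda>B. \<forall>i. transpose (block B i) ** block D i = mat 1)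
           (concat_blocks (\<lambda>i. pseudoinverse (K i) ** (block D i - E i ** H i)))"
proof -
  define B where "B i = pseudoinverse (K i) ** (block D i - E i ** H i)" for i
  have kkt: "2 *\<^sub>R (D ** transpose D) ** B i + block D i ** H i = 0"
    and feasible: "transpose (block D i) ** B i = mat 1" for i
  proof -
    obtain J where "block D i = D ** J"
      using block_eq_mult by blast
    then obtain B0 \<Lambda> where *: "2 *\<^sub>R (D ** transpose D) ** B0 + block D i ** \<Lambda> = 0"
      "transpose (block D i) ** B0 = mat 1"
      using kkt_solvable D by blast
    have G: "transpose (2 *\<^sub>R (D ** transpose D)) = 2 *\<^sub>R (D ** transpose D)"
      by (simp add: transpose_scalar matrix_transpose_mul)
    have E': "E i = 2 *\<^sub>R (D ** transpose D) ** block D i"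
      by (simp add: E flip: scalar_matrix_assoc)
    have R': "R i = block D i - 2 *\<^sub>R (D ** transpose D) ** pseudoinverse (K i) ** E i"
      by (simp add: R flip: scalar_matrix_assoc)
    \<comment> \<open>Reassociated so that everything after the kernel projection takes the place of
      \<open>W\<close>.\<close>
    have H': "H i = pseudoinverse (L i) ** transpose (S i) + (mat 1 - pseudoinverse (L i) ** L i)
        ** (matrix_inv (mat 1 + transpose (M i) ** M i)
            ** transpose (pseudoinverse (K i) ** E i) ** pseudoinverse (K i)
            ** (block D i - E i ** pseudoinverse (L i) ** transpose (S i)))"
      by (simp add: H matrix_mul_assoc)
    show "2 *\<^sub>R (D ** transpose D) ** B i + block D i ** H i = 0"
      "transpose (block D i) ** B i = mat 1"
      using kkt_solution[OF G * K E' R' S L H' B_def] by simp_all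
  qed
  show ?thesis
    unfolding is_arg_min_linorder
  proof (intro conjI allI impI)
    show "transpose (block (concat_blocks (\<lambda>i. pseudoinverse (K i) ** (block D i - E i ** H i))) i)
        ** block D i = mat 1" for i
      using arg_cong[OF feasible[of i], of transpose] by (simp add: matrix_transpose_mul B_def)
  next
    fix B' :: "real ^ ('n \<times> 'd) ^ ('m \<times> 'd)"
    assume B': "\<forall>i. transpose (block B' i) ** block D i = mat 1"
    have "norm (transpose (B i) ** D) \<le> norm (transpose (block B' i) ** D)" for i
    proof (rule kkt_optimal[OF kkt])
      show "transpose (block D i) ** B i = transpose (block D i) ** block B' i"
        using arg_cong[OF B'[rule_format, of i], of transpose] feasible
        by (simp add: matrix_transpose_mul)
    qed
    then show "1 / real CARD('d) * (frobenius_norm (transpose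
          (concat_blocks (\<lambda>i. pseudoinverse (K i) ** (block D i - E i ** H i))) ** D))\<^sup>2
        \<le> 1 / real CARD('d) * (frobenius_norm (transpose B' ** D))\<^sup>2"
      unfolding frobenius_norm_blocks
      by (intro mult_left_mono sum_mono power_mono) (simp_all add: B_def)
  qed
qed

end
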